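(* Let $s\ge 1$ and let $(X,d)$ be a complete $b$-metric space with constant $s$ and with $|X|\ge 3$. Let $T:X\to X$ be a Paired contraction, i.e. there exists $\alpha\in[0,1)$ such that $$d(Tx,Ty)+d(Ty,Tz)\le \alpha\bigl(d(x,y)+d(y,z)\bigr)$$ for all pairwise distinct $x,y,z\in X$. Then $T$ has a fixed point in $X$ if and only if $T$ has no periodic points of prime period $2$. Moreover, the number of fixed points of $T$ is at most two.
   Context: A $b$-metric with constant $s\ge 1$ on a nonempty set $X$ is a function $d:X\times X\to[0,\infty)$ such that for all $x,y,z\in X$: (a) $d(x,y)=0$ iff $x=y$; (b) $d(x,y)=d(y,x)$; (c) $d(x,z)\le s[d(x,y)+d(y,z)]$. A sequence $\{x_n\}$ converges to $x$ if $d(x_n,x)\to 0$; it is Cauchy if $d(x_n,x_m)\to 0$ as $n,m\to\infty$; $(X,d)$ is complete if every Cauchy sequence converges to a point of $X$. A fixed point of $T$ is a point $x$ with $Tx=x$. A periodic point of prime period $2$ is a point $y\in X$ with $T(Ty)=y$ and $Ty\ne y$. *)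

theory Defs
  imports Complex_Main "HOL-Library.FuncSet"
begin

(* As with the library locale Metric_space, the space is an arbitrary carrier set X and the
   axioms constrain d on X only; values of d outside X are irrelevant. *)
locale b_metric_space =
  fixes X :: "'a set" and d :: "'a \<Rightarrow> 'a \<Rightarrow> real" and s :: real
  assumes nonempty: "X \<noteq> {}"
    and s_ge_1: "s \<ge> 1"
    and nonneg: "\<lbrakk>x \<in> X; y \<in> X\<rbrakk> \<Longrightarrow> 0 \<le> d x y"
    and zero_iff: "\<lbrakk>x \<in> X; y \<in> X\<rbrakk> \<Longrightarrow> d x y = 0 \<longleftrightarrow> x = y"
    and commute: "\<lbrakk>x \<in> X; y \<in> X\<rbrakk> \<Longrightarrow> d x y = d y x"
    and relaxed_triangle:
      "\<lbrakk>x \<in> X; y \<in> X; z \<in> X\<rbrakk> \<Longrightarrow> d x z \<le> s * (d x y + d y z)"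

definition b_converges :: "('a \<Rightarrow> 'a \<Rightarrow> real) \<Rightarrow> (nat \<Rightarrow> 'a) \<Rightarrow> 'a \<Rightarrow> bool" where
  "b_converges d \<sigma> x \<longleftrightarrow> (\<lambda>n. d (\<sigma> n) x) \<longlonglongrightarrow> 0"

definition b_Cauchy :: "('a \<Rightarrow> 'a \<Rightarrow> real) \<Rightarrow> (nat \<Rightarrow> 'a) \<Rightarrow> bool" where
  "b_Cauchy d \<sigma> \<longleftrightarrow> (\<forall>\<epsilon>>0. \<exists>N. \<forall>n\<ge>N. \<forall>m\<ge>N. d (\<sigma> n) (\<sigma> m) < \<epsilon>)"

definition b_complete :: "'a set \<Rightarrow> ('a \<Rightarrow> 'a \<Rightarrow> real) \<Rightarrow> bool" where
  "b_complete X d \<longleftrightarrow>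
     (\<forall>\<sigma>. range \<sigma> \<subseteq> X \<and> b_Cauchy d \<sigma> \<longrightarrow> (\<exists>x\<in>X. b_converges d \<sigma> x))"

definition paired_contraction ::
    "'a set \<Rightarrow> ('a \<Rightarrow> 'a \<Rightarrow> real) \<Rightarrow> ('a \<Rightarrow> 'a) \<Rightarrow> bool" where
  "paired_contraction X d T \<longleftrightarrow> T \<in> X \<rightarrow> X \<and>
     (\<exists>\<alpha>. 0 \<le> \<alpha> \<and> \<alpha> < 1 \<and>
       (\<forall>x\<in>X. \<forall>y\<in>X. \<forall>z\<in>X. x \<noteq> y \<and> y \<noteq> z \<and> x \<noteq> z \<longrightarrow>
          d (T x) (T y) + d (T y) (T z) \<le> \<alpha> * (d x y + d y z)))"

definition fixed_points :: "'a set \<Rightarrow> ('a \<Rightarrow> 'a) \<Rightarrow> 'a set" where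
  "fixed_points X T = {x \<in> X. T x = x}"

definition prime_period_2_points :: "'a set \<Rightarrow> ('a \<Rightarrow> 'a) \<Rightarrow> 'a set" where
  "prime_period_2_points X T = {y \<in> X. T (T y) = y \<and> T y \<noteq> y}"

end

theory Submission
  imports Defs
begin

text \<open>
  Two of the three claims use only the contraction inequality on a well-chosen triple. Three distinct
  fixed points \<open>x, y, z\<close> would satisfy \<open>d x y + d y z \<le> \<alpha> (d x y + d y z)\<close> with a positive left-hand
  side. If \<open>p\<close> is fixed and \<open>y\<close> has prime period 2, the triple \<open>y, p, T y\<close> has \<open>p\<close> in the middle, so
  \<open>T\<close> merely exchanges the two summands of \<open>d y p + d p (T y)\<close>, which is again impossible.

  For the existence of a fixed point, suppose that there is neither a fixed point nor a point of
  prime period 2. Then any three consecutive terms of an orbit \<open>x\<^sub>n\<close> are pairwise distinct, and the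
  inequality applied to them makes the sums \<open>d x\<^sub>n x\<^sub>n\<^sub>+\<^sub>1 + d x\<^sub>n\<^sub>+\<^sub>1 x\<^sub>n\<^sub>+\<^sub>2\<close> decay like \<open>\<alpha>\<^sup>n\<close>. A sequence with
  geometrically decaying steps is Cauchy in a b-metric space even when \<open>s \<alpha> \<ge> 1\<close>
  (\<open>geometric_steps_Cauchy\<close>), so the orbit has a limit \<open>p\<close>. The map \<open>T\<close> is controlled near \<open>p\<close> only along
  pairs \<open>x\<^sub>k, x\<^sub>k\<^sub>+\<^sub>1\<close> that avoid \<open>p\<close>; since three consecutive terms are distinct, such pairs occur
  arbitrarily late (\<open>avoiding_pair\<close>), and this suffices for \<open>T p = p\<close>, a contradiction.
\<close>

section \<open>Geometric decay in b-metric spaces\<close>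

text \<open>Iterating the relaxed triangle inequality costs a factor \<open>s\<close> for each step, so this bound is
  useful only for a bounded number \<open>m\<close> of steps.\<close>

lemma (in b_metric_space) geometric_steps_short:
  assumes X: "\<And>n. \<sigma> n \<in> X"
    and step: "\<And>n. d (\<sigma> n) (\<sigma> (Suc n)) \<le> C * \<alpha> ^ n"
    and \<alpha>: "0 \<le> \<alpha>" "\<alpha> < 1" and C: "0 \<le> C"
  shows "d (\<sigma> n) (\<sigma> (n + m)) \<le> real m * s ^ m * C * \<alpha> ^ n"
proof (induction m arbitrary: n)
  case 0
  show ?case using zero_iff[OF X X, of n n] by simp
next
  case (Suc m)
  let ?B = "real m * s ^ m * C"
  have s0: "0 \<le> s" using s_ge_1 by simp
  have "0 \<le> ?B" using s0 C by simp
  moreover have "\<alpha> * \<alpha> ^ n \<le> 1 * \<alpha> ^ n"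
    using \<alpha> by (intro mult_right_mono) auto
  ultimately have decay: "?B * (\<alpha> * \<alpha> ^ n) \<le> ?B * \<alpha> ^ n"
    using mult_left_mono by fastforce
  have "1 * (C * \<alpha> ^ n) \<le> s ^ m * (C * \<alpha> ^ n)"
    using \<alpha> C s_ge_1 by (intro mult_right_mono) auto
  then have first: "d (\<sigma> n) (\<sigma> (Suc n)) \<le> s ^ m * (C * \<alpha> ^ n)"
    using step[of n] by simp
  have "d (\<sigma> n) (\<sigma> (n + Suc m))
      \<le> s * (d (\<sigma> n) (\<sigma> (Suc n)) + d (\<sigma> (Suc n)) (\<sigma> (Suc n + m)))"
    using relaxed_triangle[OF X X X] by simp
  also have "\<dots> \<le> s * (s ^ m * (C * \<alpha> ^ n) + ?B * \<alpha> ^ n)"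
    using Suc.IH[of "Suc n"] decay first s0 by (intro mult_left_mono add_mono) auto
  also have "\<dots> = real (Suc m) * s ^ Suc m * C * \<alpha> ^ n"
    by (simp add: algebra_simps)
  finally show ?case .
qed

text \<open>The factor \<open>s\<close> is harmless if it is paid only once for every \<open>N\<close> steps, where \<open>N\<close> is so large
  that \<open>s \<alpha>\<^sup>N \<le> 1/2\<close>: a block of \<open>N\<close> steps then gains more than the relaxed triangle inequality loses.
  With \<open>B \<alpha>\<^sup>n\<close> bounding all distances over at most \<open>N\<close> steps, the constant \<open>2 s B\<close> is the solution \<open>K\<close>
  of \<open>K = s B + K/2\<close>.\<close>

lemma (in b_metric_space) geometric_steps_uniform:
  assumes X: "\<And>n. \<sigma> n \<in> X"
    and step: "\<And>n. d (\<sigma> n) (\<sigma> (Suc n)) \<le> C * \<alpha> ^ n"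
    and \<alpha>: "0 \<le> \<alpha>" "\<alpha> < 1" and C: "0 \<le> C"
  obtains K where "0 \<le> K" "\<And>n m. d (\<sigma> n) (\<sigma> (n + m)) \<le> K * \<alpha> ^ n"
proof -
  have s0: "0 < s" using s_ge_1 by simp
  obtain N0 where N0: "\<alpha> ^ N0 < 1 / (2 * s)"
    using real_arch_pow_inv[of "1 / (2 * s)" \<alpha>] s0 \<alpha> by auto
  \<comment> \<open>The induction below needs blocks of positive length.\<close>
  define N where "N = Suc N0"
  have "\<alpha> ^ N \<le> \<alpha> ^ N0"
    unfolding N_def using \<alpha> by (intro power_decreasing) auto
  then have half: "s * \<alpha> ^ N \<le> 1 / 2"
    using N0 s0 mult_left_mono[of "\<alpha> ^ N" "1 / (2 * s)" s] by simp
  define B where "B = real N * s ^ N * C"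
  have B0: "0 \<le> B" using s0 C by (simp add: B_def)
  have short: "d (\<sigma> n) (\<sigma> (n + m)) \<le> B * \<alpha> ^ n" if "m \<le> N" for n m
  proof -
    have "real m * s ^ m \<le> real N * s ^ N"
      using that s_ge_1 by (intro mult_mono power_increasing) auto
    then have "real m * s ^ m * C * \<alpha> ^ n \<le> B * \<alpha> ^ n"
      unfolding B_def using C \<alpha> by (intro mult_right_mono) auto
    then show ?thesis
      using geometric_steps_short[OF X step \<alpha> C, of n m] by linarith
  qed
  define K where "K = 2 * s * B"
  have K0: "0 \<le> K" using s0 B0 by (simp add: K_def)
  have "B \<le> s * B" using mult_right_mono[OF s_ge_1 B0] by simp
  then have BK: "B \<le> K" using B0 by (simp add: K_def)
  have "d (\<sigma> n) (\<sigma> (n + m)) \<le> K * \<alpha> ^ n" for n m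
  proof (induction m arbitrary: n rule: less_induct)
    case (less m)
    show ?case
    proof (cases "m \<le> N")
      case True
      have "B * \<alpha> ^ n \<le> K * \<alpha> ^ n" using BK \<alpha> by (intro mult_right_mono) auto
      then show ?thesis using short[OF True, of n] by linarith
    next
      case False
      then have "m - N < m" and idx: "n + N + (m - N) = n + m" by (auto simp: N_def)
      then have far: "d (\<sigma> (n + N)) (\<sigma> (n + m)) \<le> K * \<alpha> ^ (n + N)"
        using less.IH[of "m - N" "n + N"] by simp
      have "d (\<sigma> n) (\<sigma> (n + m)) \<le> s * (d (\<sigma> n) (\<sigma> (n + N)) + d (\<sigma> (n + N)) (\<sigma> (n + m)))"
        by (rule relaxed_triangle[OF X X X])
      also have "\<dots> \<le> s * (B * \<alpha> ^ n + K * \<alpha> ^ (n + N))"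
        using short[of N n] far s0 by (intro mult_left_mono add_mono) auto
      also have "\<dots> = s * B * \<alpha> ^ n + (s * \<alpha> ^ N) * (K * \<alpha> ^ n)"
        by (simp add: algebra_simps power_add)
      also have "\<dots> \<le> s * B * \<alpha> ^ n + (1 / 2) * (K * \<alpha> ^ n)"
        using half K0 \<alpha> by (intro add_left_mono mult_right_mono) auto
      also have "\<dots> = K * \<alpha> ^ n" by (simp add: K_def algebra_simps)
      finally show ?thesis .
    qed
  qed
  with K0 show ?thesis by (rule that)
qed

lemma (in b_metric_space) geometric_steps_Cauchy:
  assumes X: "\<And>n. \<sigma> n \<in> X"
    and step: "\<And>n. d (\<sigma> n) (\<sigma> (Suc n)) \<le> C * \<alpha> ^ n"
    and \<alpha>: "0 \<le> \<alpha>" "\<alpha> < 1" and C: "0 \<le> C"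
  shows "b_Cauchy d \<sigma>"
  unfolding b_Cauchy_def
proof (intro allI impI)
  fix \<epsilon> :: real
  assume \<epsilon>: "0 < \<epsilon>"
  obtain K where K: "0 \<le> K" "\<And>n m. d (\<sigma> n) (\<sigma> (n + m)) \<le> K * \<alpha> ^ n"
    using geometric_steps_uniform[OF X step \<alpha> C] by blast
  have "(\<lambda>n. K * \<alpha> ^ n) \<longlonglongrightarrow> K * 0"
    using \<alpha> by (intro tendsto_mult_left LIMSEQ_realpow_zero) auto
  then have "eventually (\<lambda>n. K * \<alpha> ^ n < \<epsilon>) sequentially"
    using order_tendstoD(2)[of _ 0] \<epsilon> by simp
  then obtain N where N: "\<And>n. n \<ge> N \<Longrightarrow> K * \<alpha> ^ n < \<epsilon>"
    by (auto simp: eventually_sequentially)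
  have ordered: "d (\<sigma> n) (\<sigma> m) < \<epsilon>" if "N \<le> n" "n \<le> m" for n m
    using K(2)[of n "m - n"] N[of n] that by simp
  have "d (\<sigma> n) (\<sigma> m) < \<epsilon>" if "N \<le> n" "N \<le> m" for n m
    using ordered[of n m] ordered[of m n] commute[OF X X, of n m] that by linarith
  then show "\<exists>N. \<forall>n\<ge>N. \<forall>m\<ge>N. d (\<sigma> n) (\<sigma> m) < \<epsilon>" by blast
qed

section \<open>Paired contractions\<close>

lemma (in b_metric_space) pos: "\<lbrakk>x \<in> X; y \<in> X; x \<noteq> y\<rbrakk> \<Longrightarrow> 0 < d x y"
  using nonneg zero_iff by (simp add: order_less_le)

text \<open>The common obstruction behind the bound on fixed points and the exclusion of prime period 2:
  along three distinct points, the sum of the two adjacent distances must strictly decrease.\<close>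

lemma (in b_metric_space) paired_contraction_less:
  assumes "paired_contraction X d T"
    and "x \<in> X" "y \<in> X" "z \<in> X" "x \<noteq> y" "y \<noteq> z" "x \<noteq> z"
  shows "d (T x) (T y) + d (T y) (T z) < d x y + d y z"
proof -
  obtain \<alpha> where \<alpha>: "\<alpha> < 1" "d (T x) (T y) + d (T y) (T z) \<le> \<alpha> * (d x y + d y z)"
    using assms unfolding paired_contraction_def by blast
  have "0 < d x y + d y z" using assms by (intro add_pos_pos pos)
  with \<alpha>(1) have "\<alpha> * (d x y + d y z) < 1 * (d x y + d y z)"
    by (rule mult_strict_right_mono)
  with \<alpha>(2) show ?thesis by simp
qed

lemma (in b_metric_space) paired_contraction_card_fixed_points:
  assumes T: "paired_contraction X d T"
  shows "finite (fixed_points X T) \<and> card (fixed_points X T) \<le> 2"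
proof (rule ccontr)
  assume "\<not> ?thesis"
  then have "\<exists>A \<subseteq> fixed_points X T. card A = 3"
    by (metis infinite_arbitrarily_large obtain_subset_with_card_n not_less_eq_eq numeral_2_eq_2
        numeral_3_eq_3)
  then obtain x y z where "{x, y, z} \<subseteq> fixed_points X T" "x \<noteq> y" "y \<noteq> z" "x \<noteq> z"
    by (auto simp: card_3_iff)
  then show False
    using paired_contraction_less[OF T, of x y z] by (auto simp: fixed_points_def)
qed

lemma (in b_metric_space) paired_contraction_fixed_excludes_period_2:
  assumes T: "paired_contraction X d T" and p: "p \<in> fixed_points X T"
  shows "prime_period_2_points X T = {}"
proof (rule ccontr)
  assume "prime_period_2_points X T \<noteq> {}"
  then obtain y where y: "y \<in> X" "T (T y) = y" "T y \<noteq> y"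
    by (auto simp: prime_period_2_points_def)
  have pX: "p \<in> X" "T p = p" using p by (auto simp: fixed_points_def)
  have TyX: "T y \<in> X" using T y(1) by (auto simp: paired_contraction_def)
  have "y \<noteq> p" "p \<noteq> T y" using y pX by auto
  then have "d (T y) p + d p y < d y p + d p (T y)"
    using paired_contraction_less[OF T, of y p "T y"] y pX TyX by simp
  then show False
    using commute[OF TyX pX(1)] commute[OF y(1) pX(1)] by simp
qed

text \<open>An occurrence of \<open>p\<close> is followed by two terms different from \<open>p\<close>, so either the first pair works
  or the pair right after the occurrence of \<open>p\<close> in it.\<close>

lemma avoiding_pair:
  assumes "\<And>n. \<sigma> n \<noteq> \<sigma> (Suc n)" "\<And>n. \<sigma> n \<noteq> \<sigma> (Suc (Suc n))"
  obtains k where "n \<le> k" "\<sigma> k \<noteq> p" "\<sigma> (Suc k) \<noteq> p"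
proof -
  consider "\<sigma> n = p" | "\<sigma> (Suc n) = p" | "\<sigma> n \<noteq> p" "\<sigma> (Suc n) \<noteq> p" by blast
  then show ?thesis
  proof cases
    case 1
    then show ?thesis using assms that[of "Suc n"] by (metis le_Suc_eq order_refl)
  next
    case 2
    then show ?thesis using assms that[of "Suc (Suc n)"] by (metis le_Suc_eq order_refl)
  next
    case 3
    then show ?thesis using that[of n] by blast
  qed
qed

lemma (in b_metric_space) paired_contraction_has_fixed_point:
  assumes complete: "b_complete X d" and T: "paired_contraction X d T"
    and no_period: "prime_period_2_points X T = {}"
  shows "fixed_points X T \<noteq> {}"
proof
  assume no_fixed: "fixed_points X T = {}"
  obtain \<alpha> where \<alpha>: "0 \<le> \<alpha>" "\<alpha> < 1"
    and contr: "\<And>x y z. \<lbrakk>x \<in> X; y \<in> X; z \<in> X; x \<noteq> y; y \<noteq> z; x \<noteq> z\<rbrakk> \<Longrightarrow>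
      d (T x) (T y) + d (T y) (T z) \<le> \<alpha> * (d x y + d y z)"
    using T unfolding paired_contraction_def by blast
  have TX: "T x \<in> X" if "x \<in> X" for x
    using T that by (auto simp: paired_contraction_def)
  have T1: "T x \<noteq> x" and T2: "T (T x) \<noteq> x" if "x \<in> X" for x
    using no_fixed no_period that by (auto simp: fixed_points_def prime_period_2_points_def)
  obtain x0 where x0: "x0 \<in> X" using nonempty by blast
  define \<sigma> where "\<sigma> n = (T ^^ n) x0" for n
  have \<sigma>_Suc [simp]: "\<sigma> (Suc n) = T (\<sigma> n)" for n by (simp add: \<sigma>_def)
  have X: "\<sigma> n \<in> X" for n
    by (induction n) (simp_all add: x0 TX, simp add: \<sigma>_def x0)
  have distinct: "\<sigma> n \<noteq> \<sigma> (Suc n)" "\<sigma> n \<noteq> \<sigma> (Suc (Suc n))" for n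
    using T1[OF X] T2[OF X] by (metis \<sigma>_Suc)+
  define C where "C = d (\<sigma> 0) (\<sigma> 1) + d (\<sigma> 1) (\<sigma> 2)"
  have C0: "0 \<le> C" unfolding C_def by (intro add_nonneg_nonneg nonneg X)
  have pair: "d (\<sigma> n) (\<sigma> (Suc n)) + d (\<sigma> (Suc n)) (\<sigma> (Suc (Suc n))) \<le> C * \<alpha> ^ n" for n
  proof (induction n)
    case 0
    show ?case by (simp add: C_def numeral_2_eq_2)
  next
    case (Suc n)
    have "d (\<sigma> (Suc n)) (\<sigma> (Suc (Suc n))) + d (\<sigma> (Suc (Suc n))) (\<sigma> (Suc (Suc (Suc n))))
        \<le> \<alpha> * (d (\<sigma> n) (\<sigma> (Suc n)) + d (\<sigma> (Suc n)) (\<sigma> (Suc (Suc n))))"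
      using contr[OF X X X distinct(1) distinct(1) distinct(2), of n] by simp
    also have "\<dots> \<le> \<alpha> * (C * \<alpha> ^ n)"
      using Suc.IH \<alpha>(1) by (rule mult_left_mono)
    finally show ?case by (simp add: mult.left_commute)
  qed
  have step: "d (\<sigma> n) (\<sigma> (Suc n)) \<le> C * \<alpha> ^ n" for n
    using pair[of n] nonneg[OF X X, of "Suc n" "Suc (Suc n)"] by linarith
  have "b_Cauchy d \<sigma>"
    by (rule geometric_steps_Cauchy[OF X step \<alpha> C0])
  then obtain p where p: "p \<in> X" and lim: "(\<lambda>n. d (\<sigma> n) p) \<longlonglongrightarrow> 0"
    using complete X unfolding b_complete_def b_converges_def by blast
  have lim_Suc: "(\<lambda>n. d (\<sigma> (Suc n)) p) \<longlonglongrightarrow> 0"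
    using lim by (rule LIMSEQ_Suc)
  have lim_step: "(\<lambda>n. C * \<alpha> ^ n) \<longlonglongrightarrow> 0"
    using tendsto_mult_left[OF LIMSEQ_realpow_zero[OF \<alpha>], of C] by simp
  define r where "r n = s * ((C * \<alpha> ^ n + d (\<sigma> n) p) + d (\<sigma> (Suc n)) p)" for n
  have r: "r \<longlonglongrightarrow> 0"
    unfolding r_def
    using tendsto_mult_left[OF tendsto_add[OF tendsto_add[OF lim_step lim] lim_Suc], of s] by simp
  have bound: "d (T p) p \<le> r k" if k: "\<sigma> k \<noteq> p" "\<sigma> (Suc k) \<noteq> p" for k
  proof -
    \<comment> \<open>To compare \<open>T p\<close> with \<open>T (\<sigma> k)\<close>, the contraction inequality needs a third point; \<open>\<sigma> (Suc k)\<close>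
        serves because it is close to \<open>\<sigma> k\<close>.\<close>
    have "d (T (\<sigma> (Suc k))) (T (\<sigma> k)) + d (T (\<sigma> k)) (T p)
        \<le> \<alpha> * (d (\<sigma> (Suc k)) (\<sigma> k) + d (\<sigma> k) p)"
      by (rule contr[OF X X p distinct(1)[symmetric] k])
    also have "\<dots> \<le> 1 * (d (\<sigma> (Suc k)) (\<sigma> k) + d (\<sigma> k) p)"
      using \<alpha> by (intro mult_right_mono add_nonneg_nonneg nonneg X p) auto
    finally have "d (\<sigma> (Suc k)) (T p) \<le> d (\<sigma> (Suc k)) (\<sigma> k) + d (\<sigma> k) p"
      using nonneg[OF X X, of "Suc (Suc k)" "Suc k"] by simp
    then have near: "d (T p) (\<sigma> (Suc k)) \<le> C * \<alpha> ^ k + d (\<sigma> k) p"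
      using step[of k] commute[OF X X, of k "Suc k"] commute[OF X TX[OF p], of "Suc k"] by linarith
    have "d (T p) p \<le> s * (d (T p) (\<sigma> (Suc k)) + d (\<sigma> (Suc k)) p)"
      by (rule relaxed_triangle[OF TX[OF p] X p])
    also have "\<dots> \<le> r k"
      unfolding r_def using near s_ge_1 by (intro mult_left_mono add_right_mono) auto
    finally show ?thesis .
  qed
  have "0 < d (T p) p" using pos[OF TX[OF p] p] T1[OF p] by blast
  then obtain N where N: "\<And>n. N \<le> n \<Longrightarrow> r n < d (T p) p"
    using order_tendstoD(2)[OF r] by (auto simp: eventually_sequentially)
  obtain k where "N \<le> k" "\<sigma> k \<noteq> p" "\<sigma> (Suc k) \<noteq> p"
    using avoiding_pair[of \<sigma>] distinct by blast
  then show False using bound N by fastforce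
qed

theorem theorem4p4:
  fixes X :: "'a set" and d :: "'a \<Rightarrow> 'a \<Rightarrow> real" and s :: real and T :: "'a \<Rightarrow> 'a"
  assumes "b_metric_space X d s"
    and "b_complete X d"
    and "infinite X \<or> card X \<ge> 3"
    and "paired_contraction X d T"
  shows "(fixed_points X T \<noteq> {} \<longleftrightarrow> prime_period_2_points X T = {}) \<and>
         finite (fixed_points X T) \<and> card (fixed_points X T) \<le> 2"
proof -
  interpret b_metric_space X d s by (rule assms(1))
  show ?thesis
    using paired_contraction_fixed_excludes_period_2[OF assms(4)]
      paired_contraction_has_fixed_point[OF assms(2,4)]
      paired_contraction_card_fixed_points[OF assms(4)]
    by blast
qed

end
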